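(* Let $X$ and $Y$ be standard Borel spaces, $\mu\in\mathcal P(X)$, $\nu\in\mathcal P(Y)$ and $\pi\in\mathrm{Cpl}(\mu,\nu)$. Then there exists a Borel measurable bijection $T:X\times[0,1]\to Y\times[0,1]$ such that (i) $T_\ast(\mu\otimes\lambda)=\nu\otimes\lambda$, and (ii) writing $\mathrm{pr}_{XY}:X\times[0,1]\times Y\times[0,1]\to X\times Y$ for the projection onto the $X$ and $Y$ coordinates and $\widehat\pi:=(\mathrm{id},T)_\ast(\mu\otimes\lambda)$, one has $(\mathrm{pr}_{XY})_\ast\widehat\pi=\pi$.
   Context: $\lambda$ denotes Lebesgue measure on $[0,1]$; $\mathrm{Cpl}(\mu,\nu)$ is the set of probability measures on $X\times Y$ with marginals $\mu,\nu$; $f_\ast\mu$ denotes the push-forward. Standing assumption: all standard Borel spaces are uncountable. *)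

theory Defs
  imports "HOL-Probability.Probability"
begin

definition unit_lebesgue :: "real measure" where
  "unit_lebesgue = restrict_space lborel {0..1}"

definition Cpl :: "'a measure \<Rightarrow> 'b measure \<Rightarrow> ('a \<times> 'b) measure set" where
  "Cpl \<mu> \<nu> = {\<pi>. prob_space \<pi> \<and> sets \<pi> = sets (\<mu> \<Otimes>\<^sub>M \<nu>)
                 \<and> distr \<pi> \<mu> fst = \<mu> \<and> distr \<pi> \<nu> snd = \<nu>}"

end

theory Submission
  imports Defs
begin

text \<open>
  Randomise the coupling to \<open>\<pi> \<otimes> \<lambda>\<close> on \<open>X \<times> Y \<times> [0,1]\<close>. Coding \<open>(y, u)\<close> by a single real \<open>z\<close>, the
  conditional law of \<open>z\<close> given \<open>x\<close> is atomless because of the independent coordinate \<open>u\<close>, so its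
  conditional distribution function maps \<open>(x, z)\<close> to \<open>(x, s)\<close> with law \<open>\<mu> \<otimes> \<lambda>\<close> and is almost surely
  invertible. Hence \<open>X \<times> [0,1]\<close> and \<open>X \<times> Y \<times> [0,1]\<close> are isomorphic modulo null sets by a map that
  preserves \<open>x\<close>. Composing with the inverse of the analogous map for \<open>Y\<close> gives an isomorphism modulo
  null sets from \<open>X \<times> [0,1]\<close> to \<open>Y \<times> [0,1]\<close> that induces \<open>\<pi>\<close>. Choosing points \<open>x\<^sub>0, y\<^sub>0\<close> of measure
  zero, the exceptional sets can be enlarged by the null fibres over \<open>x\<^sub>0\<close> and \<open>y\<^sub>0\<close>; they are then
  Borel isomorphic by the Schroeder--Bernstein argument.
\<close>

subsection \<open>Borel embeddings into the reals\<close>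

text \<open>With digits in \<open>{0, 1}\<close>, base 4 makes the expansion unique.\<close>

definition base4_value :: "(nat \<Rightarrow> bool) \<Rightarrow> real" where
  "base4_value \<omega> = (\<Sum>n. (if \<omega> n then 1 else 0) * (1/4) ^ Suc n)"

text \<open>On values of expansions this deletes the leading digit; iterating it makes every digit a
  Borel function of \<open>r\<close>.\<close>

definition base4_shift :: "real \<Rightarrow> real" where
  "base4_shift r = (if 1/4 \<le> r then 4 * r - 1 else 4 * r)"

definition base4_digit :: "nat \<Rightarrow> real \<Rightarrow> bool" where
  "base4_digit n r \<longleftrightarrow> 1/4 \<le> (base4_shift ^^ n) r"

lemma summable_base4: "summable (\<lambda>n. (if \<omega> n then 1 else 0) * (1/4 :: real) ^ Suc n)"
proof (rule summable_comparison_test')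
  show "summable (\<lambda>n. (1/4 :: real) ^ Suc n)"
    by (subst summable_Suc_iff) (simp add: summable_geometric)
qed auto

lemma base4_value_bounds: "base4_value \<omega> \<in> {0..1/3}"
proof -
  have "(\<lambda>n. 1/4 * (1/4 :: real) ^ n) sums (1/4 * (1 / (1 - 1/4)))"
    by (intro sums_mult geometric_sums) simp
  then have g: "(\<lambda>n. (1/4 :: real) ^ Suc n) sums (1/3)" by simp
  have "base4_value \<omega> \<le> (\<Sum>n. (1/4 :: real) ^ Suc n)"
    unfolding base4_value_def
    by (intro suminf_le summable_base4 sums_summable[OF g]) auto
  also have "\<dots> = 1/3" using g by (simp add: sums_iff)
  finally have "base4_value \<omega> \<le> 1/3" .
  moreover have "0 \<le> base4_value \<omega>"
    unfolding base4_value_def by (intro suminf_nonneg summable_base4) auto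
  ultimately show ?thesis by simp
qed

lemma base4_value_step:
  "base4_value \<omega> = ((if \<omega> 0 then 1 else 0) + base4_value (\<lambda>n. \<omega> (Suc n))) / 4"
proof -
  have "base4_value \<omega> = (if \<omega> 0 then 1 else 0) / 4 +
      (\<Sum>n. (if \<omega> (Suc n) then 1 else 0) * (1/4) ^ Suc (Suc n))"
    unfolding base4_value_def by (subst suminf_split_head[OF summable_base4]) auto
  also have "(\<Sum>n. (if \<omega> (Suc n) then 1 else 0) * (1/4) ^ Suc (Suc n))
      = (\<Sum>n. 1/4 * ((if \<omega> (Suc n) then 1 else 0) * (1/4 :: real) ^ Suc n))"
    by (intro suminf_cong) simp
  also have "\<dots> = base4_value (\<lambda>n. \<omega> (Suc n)) / 4"
    unfolding base4_value_def by (subst suminf_mult[OF summable_base4]) simp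
  finally show ?thesis by (simp add: field_simps)
qed

text \<open>The later digits contribute at most (1/3)/4 = 1/12, so a leading 0 keeps the value below
  1/4 while a leading 1 alone reaches it.\<close>

lemma base4_value_ge_iff: "1/4 \<le> base4_value \<omega> \<longleftrightarrow> \<omega> 0"
  using base4_value_bounds[of "\<lambda>n. \<omega> (Suc n)"]
  by (subst base4_value_step) auto

lemma base4_shift_value: "base4_shift (base4_value \<omega>) = base4_value (\<lambda>n. \<omega> (Suc n))"
  unfolding base4_shift_def base4_value_ge_iff
  by (subst (1 2) base4_value_step) (auto simp: field_simps)

lemma base4_shift_funpow_value:
  "(base4_shift ^^ n) (base4_value \<omega>) = base4_value (\<lambda>k. \<omega> (n + k))"
  by (induction n) (simp_all add: base4_shift_value)

lemma base4_digit_value: "base4_digit n (base4_value \<omega>) \<longleftrightarrow> \<omega> n"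
  unfolding base4_digit_def base4_shift_funpow_value base4_value_ge_iff by simp

lemma measurable_base4_value [measurable]:
  assumes [measurable]: "\<And>n. Measurable.pred M (\<lambda>x. \<omega> x n)"
  shows "(\<lambda>x. base4_value (\<omega> x)) \<in> borel_measurable M"
  unfolding base4_value_def by measurable

lemma measurable_base4_digit [measurable]: "Measurable.pred borel (base4_digit n)"
proof -
  have [measurable]: "base4_shift \<in> borel_measurable borel"
    unfolding base4_shift_def by measurable
  have [measurable]: "(base4_shift ^^ n) \<in> borel_measurable borel" for n
    by (induction n) (auto intro: measurable_comp)
  show ?thesis unfolding base4_digit_def by measurable
qed

text \<open>A point \<open>x\<close> is coded by the bits deciding \<open>dist x a\<^sub>i < 2\<^sup>-\<^sup>k\<close> for a dense sequence \<open>a\<close>;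
  it is recovered as the limit of the first \<open>a\<^sub>i\<close> that is \<open>2\<^sup>-\<^sup>k\<close>-close.\<close>

lemma polish_borel_embedding:
  obtains e :: "'a::{complete_space, second_countable_topology} \<Rightarrow> real" and d :: "real \<Rightarrow> 'a"
  where "e \<in> borel_measurable borel" "d \<in> borel_measurable borel"
    "\<And>x. d (e x) = x" "\<And>x. e x \<in> {0..1}"
proof -
  obtain D :: "'a set" where D: "countable D" "\<And>X. open X \<Longrightarrow> X \<noteq> {} \<Longrightarrow> \<exists>d\<in>D. d \<in> X"
    using countable_dense_setE by blast
  have "D \<noteq> {}" using D(2)[of UNIV] by auto
  define a where "a = from_nat_into D"
  have ex: "\<exists>i. dist x (a i) < (1/2)^k" for x k
  proof -
    have "\<exists>d\<in>D. d \<in> ball x ((1/2)^k)" by (rule D(2)) (simp_all add: not_le)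
    then show ?thesis unfolding a_def using D(1) \<open>D \<noteq> {}\<close> by (metis from_nat_into_surj mem_ball)
  qed
  define e where "e x = base4_value (\<lambda>n. case prod_decode n of (k, i) \<Rightarrow> dist x (a i) < (1/2)^k)" for x
  define f where "f k r = a (LEAST i. base4_digit (prod_encode (k, i)) r)" for k r
  \<comment> \<open>Off the range of \<open>e\<close> the sequence may diverge; the default
    \<open>a 0\<close> keeps \<open>d\<close> a pointwise limit of Borel functions.\<close>
  define d where "d r = (if Cauchy (\<lambda>k. f k r) then lim (\<lambda>k. f k r) else a 0)" for r
  have m_f[measurable]: "f k \<in> borel_measurable borel" for k
    unfolding f_def by measurable
  have m_e: "e \<in> borel_measurable borel"
    unfolding e_def by (rule measurable_base4_value) (auto split: prod.split)
  have [measurable]: "Measurable.pred borel (\<lambda>r. Cauchy (\<lambda>k. f k r))"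
    unfolding metric_Cauchy_iff2 by measurable
  have m_d: "d \<in> borel_measurable borel"
  proof (rule borel_measurable_LIMSEQ_metric)
    show "(\<lambda>r. if Cauchy (\<lambda>k. f k r) then f i r else a 0) \<in> borel_measurable borel" for i
      by measurable
    show "(\<lambda>i. if Cauchy (\<lambda>k. f k r) then f i r else a 0) \<longlonglongrightarrow> d r" for r
      by (auto simp: d_def Cauchy_convergent_iff convergent_LIMSEQ_iff)
  qed
  have "d (e x) = x" for x
  proof -
    have fk: "dist x (f k (e x)) < (1/2)^k" for k
      unfolding f_def e_def base4_digit_value using LeastI_ex[OF ex[of x k]] by simp
    have "(\<lambda>k. dist (f k (e x)) x) \<longlonglongrightarrow> 0"
    proof (rule tendsto_sandwich[OF _ _ tendsto_const LIMSEQ_realpow_zero[of "1/2"]])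
      show "\<forall>\<^sub>F k in sequentially. dist (f k (e x)) x \<le> (1/2)^k"
        using fk by (auto simp: dist_commute less_imp_le intro!: always_eventually)
    qed auto
    then have lim: "(\<lambda>k. f k (e x)) \<longlonglongrightarrow> x" by (subst tendsto_dist_iff)
    then show ?thesis
      unfolding d_def using LIMSEQ_imp_Cauchy[OF lim] limI[OF lim] by simp
  qed
  moreover have "e x \<in> {0..1}" for x
    using base4_value_bounds[of "\<lambda>n. case prod_decode n of (k, i) \<Rightarrow> dist x (a i) < (1/2)^k"]
    unfolding e_def by auto
  ultimately show thesis using that m_e m_d by blast
qed

text \<open>The Schroeder--Bernstein construction with \<open>i\<close> and \<open>j\<close>
  carrying measurable left inverses, which makes images of Borel sets Borel.\<close>

lemma borel_Schroeder_Bernstein: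
  fixes A :: "'a::{complete_space, second_countable_topology} set"
    and B :: "'b::{complete_space, second_countable_topology} set"
  assumes [measurable]: "A \<in> sets borel" "B \<in> sets borel"
    and i[measurable]: "i \<in> borel_measurable borel" "i' \<in> borel_measurable borel"
    and j[measurable]: "j \<in> borel_measurable borel" "j' \<in> borel_measurable borel"
    and inv: "\<And>x. i' (i x) = x" "\<And>y. j' (j y) = y"
    and im: "i ` A \<subseteq> B" "j ` B \<subseteq> A"
  obtains h where "h \<in> borel_measurable borel" "bij_betw h A B"
proof -
  \<comment> \<open>\<open>C n\<close> collects the points of \<open>A\<close> whose chain of
    alternating \<open>j\<close>- and \<open>i\<close>-preimages stops, after \<open>n\<close>
    rounds, at a point outside the image of \<open>B\<close>.\<close>
  define C where "C = rec_nat (A - j ` B) (\<lambda>_ S. j ` i ` S)"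
  have C0: "C 0 = A - j ` B" and CS: "C (Suc n) = j ` i ` C n" for n
    by (simp_all add: C_def)
  have image_i: "i ` S \<in> sets borel" if [measurable]: "S \<in> sets borel" for S
  proof -
    have "i ` S = {y. i (i' y) = y \<and> i' y \<in> S}" by (auto simp: inv) (metis imageI)
    also have "\<dots> \<in> sets borel" by measurable
    finally show ?thesis .
  qed
  have image_j: "j ` S \<in> sets borel" if [measurable]: "S \<in> sets borel" for S
  proof -
    have "j ` S = {y. j (j' y) = y \<and> j' y \<in> S}" by (auto simp: inv) (metis imageI)
    also have "\<dots> \<in> sets borel" by measurable
    finally show ?thesis .
  qed
  have [measurable]: "C n \<in> sets borel" for n
    by (induction n) (auto simp: C0 CS intro!: image_i image_j sets.Diff)
  define U where "U = (\<Union>n. C n)"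
  have [measurable]: "U \<in> sets borel" unfolding U_def by measurable
  have CA: "C n \<subseteq> A" for n
    using im by (induction n) (auto simp: C0 CS)
  define h where "h x = (if x \<in> U then i x else j' x)" for x
  have notU: "\<exists>y\<in>B. x = j y" if "x \<in> A" "x \<notin> U" for x
    using that C0 unfolding U_def by (metis DiffI UN_I UNIV_I imageE)
  have step: "j (i x) \<in> U" if "x \<in> U" for x
    using that CS unfolding U_def by (metis UN_iff UNIV_I imageI)
  have "bij_betw h A B"
  proof (rule bij_betw_imageI)
    \<comment> \<open>Otherwise \<open>x' = j y\<close> gives \<open>y = i x\<close>, so
      \<open>x' = j (i x)\<close> would lie in \<open>U\<close>.\<close>
    have mixed: False if "x \<in> A" "x' \<in> A" "x \<in> U" "x' \<notin> U" "i x = j' x'" for x x'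
      using notU[OF that(2,4)] step[OF that(3)] that inv by auto
    show "inj_on h A"
    proof (rule inj_onI)
      fix x x' assume *: "x \<in> A" "x' \<in> A" "h x = h x'"
      show "x = x'"
      proof (cases "x \<in> U"; cases "x' \<in> U")
        assume "x \<in> U" "x' \<in> U"
        then show ?thesis using * inv(1) by (metis h_def)
      next
        assume "x \<notin> U" "x' \<notin> U"
        then show ?thesis using * notU inv(2) by (metis h_def)
      qed (use * mixed[of x x'] mixed[of x' x] in \<open>auto simp: h_def\<close>)
    qed
    show "h ` A = B"
    proof (intro equalityI subsetI)
      fix y assume "y \<in> h ` A"
      then obtain x where x: "x \<in> A" "y = h x" by auto
      show "y \<in> B"
        using x im(1) notU[OF x(1)] inv(2) by (cases "x \<in> U") (auto simp: h_def)
    next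
      fix y assume y: "y \<in> B"
      show "y \<in> h ` A"
      proof (cases "j y \<in> U")
        case False
        then have "h (j y) = y" by (simp add: h_def inv)
        then show ?thesis using im(2) y by (metis imageI image_subset_iff)
      next
        \<comment> \<open>A point \<open>j y\<close> is not in \<open>C 0\<close>, so it arises from
          an earlier stage as \<open>j (i x)\<close>, and cancelling \<open>j\<close> gives the
          preimage of \<open>y\<close>.\<close>
        case True
        then obtain n where n: "j y \<in> C n" by (auto simp: U_def)
        with y obtain m where m: "n = Suc m" by (cases n) (auto simp: C0)
        then obtain x where x: "x \<in> C m" "j y = j (i x)" using n by (auto simp: CS)
        then have "y = i x" by (metis inv(2))
        moreover have "x \<in> U" using x(1) by (auto simp: U_def)
        ultimately show ?thesis using x(1) CA[of m] by (auto simp: h_def intro!: image_eqI[of _ _ x])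
      qed
    qed
  qed
  moreover have "h \<in> borel_measurable borel" unfolding h_def by measurable
  ultimately show thesis using that by blast
qed


subsection \<open>Conditional distribution functions\<close>

text \<open>Carrying the measure to the whole line lets all maps be Borel maps between Polish
  spaces; membership in [0,1] becomes an almost-everywhere statement.\<close>

definition unit_borel :: "real measure" where
  "unit_borel = distr unit_lebesgue borel (\<lambda>s. s)"

lemma measurable_unit_lebesgue_id [measurable]: "(\<lambda>s. s) \<in> borel_measurable unit_lebesgue"
  unfolding unit_lebesgue_def by (rule measurable_restrict_space1) simp

lemma space_unit_lebesgue: "space unit_lebesgue = {0..1}"
  by (simp add: unit_lebesgue_def space_restrict_space)

lemma sets_unit_borel [simp, measurable_cong]: "sets unit_borel = sets borel"
  and space_unit_borel [simp]: "space unit_borel = UNIV"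
  by (simp_all add: unit_borel_def)

lemma prob_space_unit_lebesgue: "prob_space unit_lebesgue"
  by (rule prob_spaceI) (simp add: unit_lebesgue_def space_restrict_space emeasure_restrict_space)

lemma prob_space_unit_borel: "prob_space unit_borel"
  unfolding unit_borel_def
  by (rule prob_space.prob_space_distr[OF prob_space_unit_lebesgue]) measurable

lemma emeasure_unit_borel:
  assumes "S \<in> sets borel"
  shows "emeasure unit_borel S = emeasure lborel (S \<inter> {0..1})"
proof -
  have "emeasure unit_borel S = emeasure unit_lebesgue (S \<inter> {0..1})"
    unfolding unit_borel_def using assms
    by (subst emeasure_distr) (auto simp: space_unit_lebesgue)
  also have "\<dots> = emeasure lborel (S \<inter> {0..1})"
    unfolding unit_lebesgue_def using assms by (subst emeasure_restrict_space) auto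
  finally show ?thesis .
qed

lemma emeasure_unit_borel_singleton: "emeasure unit_borel {s} = 0"
proof -
  have "emeasure lborel ({s} \<inter> {0..1}) \<le> emeasure lborel {s}" by (rule emeasure_mono) auto
  then show ?thesis by (simp add: emeasure_unit_borel)
qed

lemma emeasure_unit_borel_lessThan:
  assumes "0 \<le> s" "s \<le> 1"
  shows "emeasure unit_borel {..<s} = ennreal s"
proof -
  have "{..<s} \<inter> {0..1} = {0..<s}" using assms by auto
  then show ?thesis using assms by (simp add: emeasure_unit_borel)
qed

lemma AE_unit_borel: "AE s in unit_borel. s \<in> {0..1}"
  unfolding unit_borel_def by (subst AE_distr_iff) (auto simp: space_unit_lebesgue)

text \<open>By Fubini, since a section with at most one point is null. It serves both for the
  atomlessness of conditional laws and for graphs of functions.\<close>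

lemma emeasure_pair_thin_sections:
  assumes "E \<in> sets (M \<Otimes>\<^sub>M unit_borel)"
    and thin: "\<And>x s s'. (x, s) \<in> E \<Longrightarrow> (x, s') \<in> E \<Longrightarrow> s = s'"
  shows "emeasure (M \<Otimes>\<^sub>M unit_borel) E = 0"
proof -
  interpret U: prob_space unit_borel by (rule prob_space_unit_borel)
  have "emeasure unit_borel (Pair x -` E) = 0" for x
  proof (cases "Pair x -` E = {}")
    case False
    then obtain s where "Pair x -` E = {s}" using thin by blast
    then show ?thesis by (simp add: emeasure_unit_borel_singleton)
  qed auto
  then show ?thesis
    by (subst U.emeasure_pair_measure_alt[OF assms(1)]) simp
qed

text \<open>Here \<open>h r x\<close> is a version of the conditional probability \<open>R(z \<le> r | x)\<close>, and \<open>null_thin\<close>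
  expresses that the conditional laws of \<open>R\<close> given \<open>x\<close> have no atoms.\<close>

locale conditional_cdf = M: prob_space M + R: prob_space R
  for M :: "'a measure" and R :: "('a \<times> real) measure" +
  fixes h :: "real \<Rightarrow> 'a \<Rightarrow> ennreal"
  assumes sets_R [measurable_cong]: "sets R = sets (M \<Otimes>\<^sub>M borel)"
    and measurable_h [measurable]: "\<And>r. h r \<in> borel_measurable M"
    and h: "\<And>A r. A \<in> sets M \<Longrightarrow> (\<integral>\<^sup>+x\<in>A. h r x \<partial>M) = emeasure R (A \<times> {..r})"
    and marginal: "\<And>A. A \<in> sets M \<Longrightarrow> emeasure R (A \<times> UNIV) = emeasure M A"
    and null_thin: "\<And>E. E \<in> sets R \<Longrightarrow>
      (\<And>x z z'. (x, z) \<in> E \<Longrightarrow> (x, z') \<in> E \<Longrightarrow> z = z') \<Longrightarrow> emeasure R E = 0"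
begin

lemma space_R: "space R = space M \<times> UNIV"
  using sets_eq_imp_space_eq[OF sets_R] by (simp add: space_pair_measure)

text \<open>A regularised conditional distribution function: the versions \<open>h r\<close> are
  chosen separately for each \<open>r\<close>, but an infimum over the rationals from z upwards is
  monotone in z by construction.\<close>

definition F :: "'a \<times> real \<Rightarrow> ennreal" where
  "F p = (INF r\<in>\<rat>. if snd p \<le> r then h r (fst p) else \<top>)"

text \<open>With the rationals as \<open>Q\<close> this is the event \<open>F p < s\<close> over
  \<open>A\<close>. Finite \<open>Q\<close> approximate it, and the induction on \<open>Q\<close>
  splits \<open>A\<close>.\<close>

definition below :: "ennreal \<Rightarrow> real set \<Rightarrow> 'a set \<Rightarrow> ('a \<times> real) set" where
  "below s Q A = {p \<in> space R. fst p \<in> A \<and> (\<exists>r\<in>Q. snd p \<le> r \<and> h r (fst p) < s)}"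

text \<open>The counterpart for the opposite bound: it decreases in \<open>Q\<close> where
  \<open>below\<close> increases, and for the rationals the two differ at most by a conditional
  quantile.\<close>

definition under :: "ennreal \<Rightarrow> real set \<Rightarrow> 'a set \<Rightarrow> ('a \<times> real) set" where
  "under s Q A = {p \<in> space R. fst p \<in> A \<and> (\<forall>r\<in>Q. s \<le> h r (fst p) \<longrightarrow> snd p \<le> r)}"

lemma sets_below:
  assumes [simp]: "countable Q" and [measurable]: "A \<in> sets M"
  shows "below s Q A \<in> sets R"
  unfolding below_def by measurable

lemma sets_under:
  assumes [simp]: "countable Q" and [measurable]: "A \<in> sets M"
  shows "under s Q A \<in> sets R"
  unfolding under_def by measurable

lemma measurable_F [measurable]: "F \<in> borel_measurable (M \<Otimes>\<^sub>M borel)"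
  unfolding F_def by (rule borel_measurable_INF) (simp_all add: countable_rat)

lemma F_mono: "z \<le> z' \<Longrightarrow> F (x, z) \<le> F (x, z')"
  unfolding F_def by (rule INF_mono') auto

lemma F_less_iff: "F p < s \<longleftrightarrow> (\<exists>r\<in>\<rat>. snd p \<le> r \<and> h r (fst p) < s)"
  unfolding F_def INF_less_iff by (auto split: if_splits)

text \<open>The induction adds the largest point \<open>r\<close>. Where \<open>h r x < s\<close>,
  every witness forces z \<le> r, an event of mass at most \<open>s\<close> times that of the base;
  elsewhere \<open>r\<close> is no witness and the induction hypothesis applies.\<close>

lemma emeasure_below_finite:
  assumes "finite Q" "A \<in> sets M"
  shows "emeasure R (below s Q A) \<le> s * emeasure M A"
  using assms
proof (induction Q arbitrary: A rule: finite_linorder_max_induct)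
  case empty
  then show ?case by (simp add: below_def)
next
  case (insert r Q)
  note [measurable] = insert.prems
  define B where "B = {x\<in>A. h r x < s}"
  have "B = {x\<in>space M. x \<in> A \<and> h r x < s}"
    using sets.sets_into_space[OF insert.prems] by (auto simp: B_def)
  also have "\<dots> \<in> sets M" by measurable
  finally have B[measurable]: "B \<in> sets M" .
  have S: "B \<times> {..r} \<in> sets R" "below s Q (A - B) \<in> sets R"
    by (simp add: sets_R) (intro sets_below countable_finite insert.hyps(1), measurable)
  have "below s (insert r Q) A \<subseteq> B \<times> {..r} \<union> below s Q (A - B)"
    using insert.hyps by (force simp: below_def B_def)
  then have "emeasure R (below s (insert r Q) A) \<le> emeasure R (B \<times> {..r} \<union> below s Q (A - B))"
    by (rule emeasure_mono) (use S in auto)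
  also have "\<dots> \<le> emeasure R (B \<times> {..r}) + emeasure R (below s Q (A - B))"
    by (rule emeasure_subadditive) (use S in auto)
  also have "emeasure R (B \<times> {..r}) \<le> s * emeasure M B"
  proof -
    have "emeasure R (B \<times> {..r}) = (\<integral>\<^sup>+x\<in>B. h r x \<partial>M)" by (simp add: h)
    also have "\<dots> \<le> (\<integral>\<^sup>+x. s * indicator B x \<partial>M)"
      by (intro nn_integral_mono) (auto simp: B_def indicator_def intro: less_imp_le)
    finally show ?thesis by (simp add: nn_integral_cmult_indicator)
  qed
  also have "emeasure R (below s Q (A - B)) \<le> s * emeasure M (A - B)"
    by (rule insert.IH) measurable
  also have "s * emeasure M B + s * emeasure M (A - B) = s * emeasure M A"
  proof -
    have "emeasure M B + emeasure M (A - B) = emeasure M A"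
      by (subst plus_emeasure) (auto simp: B_def intro!: arg_cong[where f="emeasure M"])
    then show ?thesis by (metis distrib_left)
  qed
  finally show ?case by (simp add: add_mono)
qed

text \<open>Dually, the induction adds the smallest point \<open>r\<close>. Where
  \<open>s \<le> h r x\<close>, the event z \<le> r implies all constraints and has enough mass;
  elsewhere \<open>r\<close> imposes nothing. The empty \<open>Q\<close> is the place for
  \<open>s \<le> 1\<close>.\<close>

lemma emeasure_under_finite:
  assumes "finite Q" "A \<in> sets M" "s \<le> 1"
  shows "s * emeasure M A \<le> emeasure R (under s Q A)"
  using assms(1,2)
proof (induction Q arbitrary: A rule: finite_linorder_min_induct)
  case empty
  have "under s {} A = A \<times> UNIV"
    using sets.sets_into_space[OF empty.prems] by (auto simp: under_def space_R)
  then show ?case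
    using mult_right_mono[OF assms(3), of "emeasure M A"] by (simp add: marginal empty.prems)
next
  case (insert r Q)
  note [measurable] = insert.prems
  define B where "B = {x\<in>A. s \<le> h r x}"
  have "B = {x\<in>space M. x \<in> A \<and> s \<le> h r x}"
    using sets.sets_into_space[OF insert.prems] by (auto simp: B_def)
  also have "\<dots> \<in> sets M" by measurable
  finally have B[measurable]: "B \<in> sets M" .
  have S: "B \<times> {..r} \<in> sets R" "under s Q (A - B) \<in> sets R" "under s (insert r Q) A \<in> sets R"
    by (simp add: sets_R) (rule sets_under; use insert.hyps(1) in \<open>simp add: countable_finite\<close>)+
  have "s * emeasure M A = s * emeasure M B + s * emeasure M (A - B)"
  proof -
    have "emeasure M B + emeasure M (A - B) = emeasure M A"
      by (subst plus_emeasure) (auto simp: B_def intro!: arg_cong[where f="emeasure M"])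
    then show ?thesis by (metis distrib_left)
  qed
  also have "s * emeasure M B \<le> emeasure R (B \<times> {..r})"
  proof -
    have "s * emeasure M B = (\<integral>\<^sup>+x. s * indicator B x \<partial>M)"
      by (simp add: nn_integral_cmult_indicator)
    also have "\<dots> \<le> (\<integral>\<^sup>+x\<in>B. h r x \<partial>M)"
      by (intro nn_integral_mono) (auto simp: B_def indicator_def)
    finally show ?thesis by (simp add: h)
  qed
  also have "s * emeasure M (A - B) \<le> emeasure R (under s Q (A - B))"
    by (rule insert.IH) measurable
  also have "emeasure R (B \<times> {..r}) + emeasure R (under s Q (A - B))
      = emeasure R (B \<times> {..r} \<union> under s Q (A - B))"
    by (intro plus_emeasure S(1,2)) (auto simp: under_def)
  also have "\<dots> \<le> emeasure R (under s (insert r Q) A)"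
  proof (rule emeasure_mono)
    show "B \<times> {..r} \<union> under s Q (A - B) \<subseteq> under s (insert r Q) A"
      using insert.hyps sets.sets_into_space[OF B]
      by (force simp: under_def B_def space_R)
  qed (rule S)
  finally show ?case by (simp add: add_mono)
qed

lemma finite_exhaustion_Rats:
  obtains Q :: "nat \<Rightarrow> real set" where "\<And>n. finite (Q n)" "incseq Q" "(\<Union>n. Q n) = \<rat>"
proof
  have "range (from_nat_into \<rat>) = (\<rat> :: real set)"
    by (rule range_from_nat_into) (auto simp: countable_rat)
  then show "(\<Union>n. from_nat_into \<rat> ` {..n}) = (\<rat> :: real set)" by blast
  show "incseq (\<lambda>n. from_nat_into (\<rat> :: real set) ` {..n})" by (force simp: incseq_def)
qed auto

lemma emeasure_below_Rats:
  assumes A: "A \<in> sets M"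
  shows "emeasure R (below s \<rat> A) \<le> s * emeasure M A"
proof -
  obtain Q :: "nat \<Rightarrow> real set" where Q: "\<And>n. finite (Q n)" "incseq Q" "(\<Union>n. Q n) = \<rat>"
    using finite_exhaustion_Rats by blast
  have "emeasure R (below s \<rat> A) = emeasure R (\<Union>n. below s (Q n) A)"
    by (intro arg_cong[where f="emeasure R"]) (auto simp: below_def Q(3)[symmetric])
  also have "\<dots> = (SUP n. emeasure R (below s (Q n) A))"
  proof (rule SUP_emeasure_incseq[symmetric])
    show "range (\<lambda>n. below s (Q n) A) \<subseteq> sets R"
      using Q(1) A by (auto intro: sets_below countable_finite)
    show "incseq (\<lambda>n. below s (Q n) A)"
      using Q(2) unfolding incseq_def below_def by blast
  qed
  also have "\<dots> \<le> s * emeasure M A"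
    by (rule SUP_least, rule emeasure_below_finite) (use Q(1) A in auto)
  finally show ?thesis .
qed

lemma emeasure_under_Rats:
  assumes A: "A \<in> sets M" and "s \<le> 1"
  shows "s * emeasure M A \<le> emeasure R (under s \<rat> A)"
proof -
  obtain Q :: "nat \<Rightarrow> real set" where Q: "\<And>n. finite (Q n)" "incseq Q" "(\<Union>n. Q n) = \<rat>"
    using finite_exhaustion_Rats by blast
  have "s * emeasure M A \<le> (INF n. emeasure R (under s (Q n) A))"
    by (rule INF_greatest, rule emeasure_under_finite) (use Q(1) assms in auto)
  also have "\<dots> = emeasure R (\<Inter>n. under s (Q n) A)"
  proof (rule INF_emeasure_decseq)
    show "range (\<lambda>n. under s (Q n) A) \<subseteq> sets R"
      using Q(1) A by (auto intro: sets_under countable_finite)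
    show "decseq (\<lambda>n. under s (Q n) A)"
      using Q(2) unfolding incseq_def decseq_def under_def by blast
  qed auto
  also have "\<dots> = emeasure R (under s \<rat> A)"
    by (intro arg_cong[where f="emeasure R"]) (auto simp: under_def Q(3)[symmetric])
  finally show ?thesis .
qed

text \<open>A point of \<open>under s \<rat> A\<close> outside \<open>below s \<rat> A\<close> is the conditional \<open>s\<close>-quantile,
  so by \<open>null_thin\<close> both bounds are equalities, although \<open>h\<close> is not known to be monotone in \<open>r\<close>.\<close>

lemma emeasure_F_less:
  assumes A[measurable]: "A \<in> sets M" and "s \<le> 1"
  shows "emeasure R {p \<in> space R. fst p \<in> A \<and> F p < s} = s * emeasure M A"
proof -
  have "{p \<in> space R. fst p \<in> A \<and> F p < s} = below s \<rat> A"
    by (auto simp: below_def F_less_iff)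
  moreover have "emeasure R (below s \<rat> A) = s * emeasure M A"
  proof (rule antisym)
    have sets: "below s \<rat> A \<in> sets R" "under s \<rat> A \<in> sets R"
      by (simp_all add: sets_below sets_under countable_rat)
    have null: "emeasure R (under s \<rat> A - below s \<rat> A) = 0"
    proof (rule null_thin)
      \<comment> \<open>A rational r between z and z' decides: \<open>s \<le> h r x\<close>
        contradicts (x, z') in \<open>under\<close>, and \<open>h r x < s\<close> puts (x, z) into
        \<open>below\<close>.\<close>
      have less: False if "(x, z) \<in> under s \<rat> A - below s \<rat> A"
        "(x, z') \<in> under s \<rat> A - below s \<rat> A" "z < z'" for x z z'
      proof -
        obtain r where r: "r \<in> \<rat>" "z < r" "r < z'" using Rats_dense_in_real[OF \<open>z < z'\<close>] by blast
        show False
        proof (cases "s \<le> h r x")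
          case True
          then show False using that(2) r by (auto simp: under_def)
        next
          case False
          then show False using that(1) r by (auto simp: under_def below_def not_le)
        qed
      qed
      show "z = z'" if "(x, z) \<in> under s \<rat> A - below s \<rat> A"
        "(x, z') \<in> under s \<rat> A - below s \<rat> A" for x z z'
        using less[OF that] less[OF that(2,1)] by (cases z z' rule: linorder_cases) blast+
    qed (use sets in auto)
    have "s * emeasure M A \<le> emeasure R (under s \<rat> A)"
      by (rule emeasure_under_Rats) fact+
    also have "\<dots> \<le> emeasure R (below s \<rat> A \<union> (under s \<rat> A - below s \<rat> A))"
      by (rule emeasure_mono) (use sets in auto)
    also have "\<dots> \<le> emeasure R (below s \<rat> A) + emeasure R (under s \<rat> A - below s \<rat> A)"
      by (rule emeasure_subadditive) (use sets in auto)
    finally show "s * emeasure M A \<le> emeasure R (below s \<rat> A)" by (simp add: null)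
  qed (rule emeasure_below_Rats[OF A])
  ultimately show ?thesis by simp
qed

text \<open>The case \<open>s = 1\<close> over the whole space has full mass. In particular
  \<open>F\<close> is almost surely finite, so \<open>enn2real\<close> loses nothing.\<close>

lemma AE_F_less_1: "AE p in R. F p < 1"
proof (rule R.AE_I_eq_1)
  show "emeasure R {p \<in> space R. F p < 1} = 1"
    using emeasure_F_less[of "space M" 1] M.emeasure_space_1
    by (simp add: space_R mem_Times_iff conj_assoc[symmetric] del: conj_assoc)
qed measurable

section \<open>Uniform law of the conditional distribution function, and its inverse\<close>

lemma measurable_quantile_transform [measurable]:
  "(\<lambda>p. (fst p, enn2real (F p))) \<in> R \<rightarrow>\<^sub>M M \<Otimes>\<^sub>M unit_borel"
  by measurable

lemma emeasure_quantile_transform_lessThan: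
  assumes A[measurable]: "A \<in> sets M"
  shows "emeasure R {p \<in> space R. fst p \<in> A \<and> enn2real (F p) < s}
     = emeasure M A * emeasure unit_borel {..<s}"
proof -
  \<comment> \<open>\<open>emeasure_F_less\<close> serves s in [0,1]; beyond that range the values
    of \<open>F\<close> and the mass of \<open>unit_borel\<close> are both confined to
    [0,1].\<close>
  consider "s < 0" | "0 \<le> s" "s \<le> 1" | "1 < s" by linarith
  then show ?thesis
  proof cases
    case 1
    then have "{p \<in> space R. fst p \<in> A \<and> enn2real (F p) < s} = {}" "{..<s} \<inter> {0..1} = {}"
      using order.strict_trans1[OF enn2real_nonneg] by fastforce+
    then show ?thesis by (simp only: emeasure_unit_borel emeasure_empty mult_zero_right lessThan_borel)
  next
    case 2
    have "emeasure R {p \<in> space R. fst p \<in> A \<and> enn2real (F p) < s}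
      = emeasure R {p \<in> space R. fst p \<in> A \<and> F p < ennreal s}"
    proof (rule emeasure_eq_AE)
      show "AE p in R. p \<in> {p \<in> space R. fst p \<in> A \<and> enn2real (F p) < s}
          \<longleftrightarrow> p \<in> {p \<in> space R. fst p \<in> A \<and> F p < ennreal s}"
        using AE_F_less_1
      proof eventually_elim
        case (elim p)
        then show ?case by (cases "F p") (simp_all add: ennreal_less_iff)
      qed
    qed measurable
    then show ?thesis
      using 2 by (simp add: emeasure_F_less emeasure_unit_borel_lessThan mult.commute)
  next
    case 3
    have "emeasure R {p \<in> space R. fst p \<in> A \<and> enn2real (F p) < s} = emeasure R (A \<times> UNIV)"
    proof (rule emeasure_eq_AE)
      show "AE p in R. p \<in> {p \<in> space R. fst p \<in> A \<and> enn2real (F p) < s} \<longleftrightarrow> p \<in> A \<times> UNIV"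
        using AE_F_less_1 AE_space
      proof eventually_elim
        case (elim p)
        then have "enn2real (F p) < s" using 3 
          by (cases "F p") (simp_all add: ennreal_less_one_iff)
        with elim show ?case by (auto simp: mem_Times_iff)
      qed
    qed measurable
    moreover have "{..<s} \<inter> {0..1} = {0..1}" using 3 by auto
    ultimately show ?thesis by (simp add: marginal emeasure_unit_borel)
  qed
qed

lemma distr_quantile_transform:
  "distr R (M \<Otimes>\<^sub>M unit_borel) (\<lambda>p. (fst p, enn2real (F p))) = M \<Otimes>\<^sub>M unit_borel"
proof (rule pair_measure_eqI[symmetric])
  interpret U: prob_space unit_borel by (rule prob_space_unit_borel)
  show "sigma_finite_measure M" "sigma_finite_measure unit_borel" by unfold_locales
  fix A B assume A[measurable]: "A \<in> sets M" and "B \<in> sets unit_borel"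
  then have B[measurable]: "B \<in> sets borel" by simp
  \<comment> \<open>For fixed \<open>A\<close> the claim on rectangles becomes an equality of finite
    measures on the line, which can be tested on half-lines.\<close>
  define N where "N = distr (density R (indicator (A \<times> UNIV))) borel (\<lambda>p. enn2real (F p))"
  have N: "emeasure N S = emeasure R {p \<in> space R. fst p \<in> A \<and> enn2real (F p) \<in> S}"
    if [measurable]: "S \<in> sets borel" for S
  proof -
    have "emeasure N S = emeasure (density R (indicator (A \<times> UNIV))) {p \<in> space R. enn2real (F p) \<in> S}"
      unfolding N_def by (subst emeasure_distr) (auto intro!: arg_cong2[where f=emeasure])
    also have "\<dots> = (\<integral>\<^sup>+p. indicator (A \<times> UNIV) p * indicator {p \<in> space R. enn2real (F p) \<in> S} p \<partial>R)"
      by (rule emeasure_density) measurable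
    also have "\<dots> = (\<integral>\<^sup>+p. indicator {p \<in> space R. fst p \<in> A \<and> enn2real (F p) \<in> S} p \<partial>R)"
      by (intro nn_integral_cong) (auto simp: indicator_def)
    also have "\<dots> = emeasure R {p \<in> space R. fst p \<in> A \<and> enn2real (F p) \<in> S}"
      by (rule nn_integral_indicator) measurable
    finally show ?thesis .
  qed
  have "N = scale_measure (emeasure M A) unit_borel"
  proof (rule measure_eqI_generator_eq[where E="range lessThan" and \<Omega>=UNIV
      and A="\<lambda>i. {..<real i}"])
    have "{..<a} \<inter> {..<b} = {..<min a b}" for a b :: real by auto
    then show "Int_stable (range (lessThan :: real \<Rightarrow> _))" unfolding Int_stable_def by blast
    show "emeasure N X = emeasure (scale_measure (emeasure M A) unit_borel) X"
      if "X \<in> range lessThan" for X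
      using that by (auto simp: N emeasure_quantile_transform_lessThan)
    have "sets (borel :: real measure) = sigma_sets UNIV (range lessThan)"
      by (subst borel_Iio) simp
    then show "sets N = sigma_sets UNIV (range lessThan)"
      "sets (scale_measure (emeasure M A) unit_borel) = sigma_sets UNIV (range lessThan)"
      by (simp_all add: N_def)
    show "(\<Union>i::nat. {..<real i}) = UNIV" using reals_Archimedean2 by blast
    show "emeasure N {..<real i} \<noteq> \<infinity>" for i by (simp add: N)
    show "range (\<lambda>i::nat. {..<real i}) \<subseteq> range lessThan" by blast
  qed simp
  then have "emeasure M A * emeasure unit_borel B = emeasure N B" by simp
  also have "\<dots> = emeasure (distr R (M \<Otimes>\<^sub>M unit_borel) (\<lambda>p. (fst p, enn2real (F p)))) (A \<times> B)"
    by (subst emeasure_distr) (auto simp: N intro!: arg_cong2[where f=emeasure])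
  finally show "emeasure M A * emeasure unit_borel B =
      emeasure (distr R (M \<Otimes>\<^sub>M unit_borel) (\<lambda>p. (fst p, enn2real (F p)))) (A \<times> B)" .
qed simp

text \<open>Under the transformed law the graph of each function sending x to
  \<open>F (x, q)\<close> has one-point sections and is null. Hence \<open>F\<close> almost surely
  separates z from every rational.\<close>

lemma AE_F_Rats: "AE p in R. \<forall>q\<in>\<rat>. F (fst p, q) \<noteq> F p"
proof (subst AE_ball_countable[OF countable_rat], intro ballI)
  fix q :: real
  define E where "E = {p \<in> space (M \<Otimes>\<^sub>M unit_borel). snd p = enn2real (F (fst p, q))}"
  have E: "E \<in> sets (M \<Otimes>\<^sub>M unit_borel)" unfolding E_def by measurable
  then have "emeasure (M \<Otimes>\<^sub>M unit_borel) E = 0"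
    by (rule emeasure_pair_thin_sections) (auto simp: E_def)
  then have "AE p in M \<Otimes>\<^sub>M unit_borel. p \<notin> E"
    using E by (intro AE_not_in) auto
  then have "AE p in M \<Otimes>\<^sub>M unit_borel. snd p \<noteq> enn2real (F (fst p, q))"
    by (rule AE_mp) (auto simp: E_def)
  then have "AE p in distr R (M \<Otimes>\<^sub>M unit_borel) (\<lambda>p. (fst p, enn2real (F p))).
      snd p \<noteq> enn2real (F (fst p, q))"
    by (simp only: distr_quantile_transform)
  then have "AE p in R. enn2real (F p) \<noteq> enn2real (F (fst p, q))"
    by (auto dest: AE_distrD[OF measurable_quantile_transform])
  then show "AE p in R. F (fst p, q) \<noteq> F p" by eventually_elim auto
qed

text \<open>The generalised inverse of \<open>F\<close> in its second argument; the infimum is taken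
  in \<open>ereal\<close>, where it always exists.\<close>

definition quantile :: "'a \<times> real \<Rightarrow> real" where
  "quantile p = real_of_ereal (INF q\<in>\<rat>. if ennreal (snd p) < F (fst p, q) then ereal q else \<infinity>)"

lemma measurable_quantile: "quantile \<in> borel_measurable (M \<Otimes>\<^sub>M borel)"
proof -
  have "(\<lambda>p. INF q\<in>\<rat>. if ennreal (snd p) < F (fst p, q) then ereal q else \<infinity>)
      \<in> borel_measurable (M \<Otimes>\<^sub>M borel)"
    by (rule borel_measurable_INF) (simp_all add: countable_rat)
  then show ?thesis unfolding quantile_def by measurable
qed

lemma AE_quantile_F: "AE p in R. quantile (fst p, enn2real (F p)) = snd p"
  using AE_F_Rats AE_F_less_1
proof eventually_elim
  case (elim p)
  obtain x z where p: "p = (x, z)" by (cases p)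
  have "F p < \<top>" using elim(2) by (rule order.strict_trans) simp
  \<comment> \<open>Monotonicity gives this up to ties, and ties with rationals are excluded;
    density of the rationals then identifies the infimum as z.\<close>
  have iff: "F p < F (x, q) \<longleftrightarrow> z < q" if "q \<in> \<rat>" for q
    using elim(1) that F_mono[of z q x] F_mono[of q z x]
    by (cases "z < q") (auto simp: p order.strict_iff_order not_less)
  have "(INF q\<in>\<rat>. if F p < F (x, q) then ereal q else \<infinity>) = (INF q\<in>\<rat>. if z < q then ereal q else \<infinity>)"
    by (intro INF_cong) (auto simp: iff)
  also have "\<dots> = ereal z"
  proof (rule antisym)
    show "ereal z \<le> (INF q\<in>\<rat>. if z < q then ereal q else \<infinity>)" by (rule INF_greatest) auto
    show "(INF q\<in>\<rat>. if z < q then ereal q else \<infinity>) \<le> ereal z"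
    proof (rule ccontr)
      assume "\<not> ?thesis"
      then obtain w where w: "ereal z < ereal w" "ereal w < (INF q\<in>\<rat>. if z < q then ereal q else \<infinity>)"
        using ereal_dense2[of "ereal z"] unfolding not_le by blast
      then obtain q where q: "q \<in> \<rat>" "z < q" "q < w" using Rats_dense_in_real[of z w] by auto
      then have "(INF q\<in>\<rat>. if z < q then ereal q else \<infinity>) \<le> ereal q"
        by (intro INF_lower2[of q]) auto
      with w(2) q(3) show False 
        using order.strict_trans2[of "ereal w"] by fastforce
    qed
  qed
  finally show ?case using \<open>F p < \<top>\<close> by (simp add: quantile_def p)
qed

end

text \<open>Radon-Nikodym derivatives supply the versions \<open>h r\<close>; \<open>v\<close> is
  then the conditional distribution function and \<open>w\<close> its quantile function.\<close>

lemma conditional_uniformization: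
  assumes "prob_space M" "prob_space R"
    and sets_R[measurable_cong]: "sets R = sets (M \<Otimes>\<^sub>M borel)"
    and marginal: "distr R M fst = M"
    and null_thin: "\<And>E. E \<in> sets R \<Longrightarrow>
      (\<And>x z z'. (x, z) \<in> E \<Longrightarrow> (x, z') \<in> E \<Longrightarrow> z = z') \<Longrightarrow> emeasure R E = 0"
  obtains v w :: "'a \<times> real \<Rightarrow> real"
  where "v \<in> borel_measurable (M \<Otimes>\<^sub>M borel)" "w \<in> borel_measurable (M \<Otimes>\<^sub>M borel)"
    "distr R (M \<Otimes>\<^sub>M unit_borel) (\<lambda>p. (fst p, v p)) = M \<Otimes>\<^sub>M unit_borel"
    "AE p in R. w (fst p, v p) = snd p"
proof -
  interpret M: prob_space M by fact
  interpret R: prob_space R by fact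
  have space_R: "space R = space M \<times> UNIV"
    using sets_eq_imp_space_eq[OF sets_R] by (simp add: space_pair_measure)
  have marg: "emeasure R (A \<times> UNIV) = emeasure M A" if A: "A \<in> sets M" for A
  proof -
    have "emeasure M A = emeasure (distr R M fst) A" by (simp add: marginal)
    also have "\<dots> = emeasure R (fst -` A \<inter> space R)" using A by (subst emeasure_distr) auto
    also have "fst -` A \<inter> space R = A \<times> UNIV"
      using sets.sets_into_space[OF A] by (auto simp: space_R)
    finally show ?thesis ..
  qed
  \<comment> \<open>The part of the first marginal coming from z \<le> r; its density is the
    conditional probability of that event.\<close>
  define N where "N r = distr (density R (indicator (space M \<times> {..r}))) M fst" for r :: real
  have N: "emeasure (N r) A = emeasure R (A \<times> {..r})" if A[measurable]: "A \<in> sets M" for A r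
  proof -
    have sub: "A \<subseteq> space M" using A by (rule sets.sets_into_space)
    have "emeasure (N r) A = emeasure (density R (indicator (space M \<times> {..r}))) (A \<times> UNIV)"
      unfolding N_def using sub
      by (subst emeasure_distr) (auto simp: space_R intro!: arg_cong2[where f=emeasure])
    also have "\<dots> = (\<integral>\<^sup>+p. indicator (space M \<times> {..r}) p * indicator (A \<times> UNIV) p \<partial>R)"
      by (rule emeasure_density) measurable
    also have "\<dots> = (\<integral>\<^sup>+p. indicator (A \<times> {..r}) p \<partial>R)"
      using sub by (intro nn_integral_cong) (auto simp: indicator_def)
    also have "\<dots> = emeasure R (A \<times> {..r})" by (rule nn_integral_indicator) measurable
    finally show ?thesis .
  qed
  have ac: "absolutely_continuous M (N r)" for r
  proof -
    have "emeasure (N r) A = 0" if A: "A \<in> sets M" "emeasure M A = 0" for A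
    proof -
      have "emeasure R (A \<times> {..r}) \<le> emeasure R (A \<times> UNIV)"
        using A(1) by (intro emeasure_mono) (auto simp: sets_R)
      then show ?thesis using A by (simp add: N marg)
    qed
    then show ?thesis
      by (auto simp: absolutely_continuous_def null_sets_def N_def)
  qed
  interpret conditional_cdf M R "\<lambda>r. RN_deriv M (N r)"
  proof
    fix A r assume A: "A \<in> sets M"
    have "(\<integral>\<^sup>+x\<in>A. RN_deriv M (N r) x \<partial>M) = emeasure (density M (RN_deriv M (N r))) A"
      using A by (simp add: emeasure_density)
    also have "density M (RN_deriv M (N r)) = N r"
      by (rule M.density_RN_deriv[OF ac]) (simp add: N_def)
    finally show "(\<integral>\<^sup>+x\<in>A. RN_deriv M (N r) x \<partial>M) = emeasure R (A \<times> {..r})"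
      using A by (simp add: N)
  qed (fact sets_R borel_measurable_RN_deriv marg null_thin)+
  show thesis
  proof (rule that)
    show "(\<lambda>p. enn2real (F p)) \<in> borel_measurable (M \<Otimes>\<^sub>M borel)" by measurable
  qed (rule measurable_quantile distr_quantile_transform AE_quantile_F)+
qed


subsection \<open>Couplings and isomorphisms modulo null sets\<close>

lemma distr_AE_left_inverse:
  assumes p[measurable]: "p \<in> M \<rightarrow>\<^sub>M N" and q[measurable]: "q \<in> N \<rightarrow>\<^sub>M M"
    and p_distr: "distr M N p = N" and inv: "AE x in M. q (p x) = x"
  shows "distr N M q = M"
proof -
  have "distr N M q = distr (distr M N p) M q" by (simp add: p_distr)
  also have "\<dots> = distr M M (\<lambda>x. q (p x))" by (simp add: distr_distr comp_def)
  also have "\<dots> = distr M M (\<lambda>x. x)" by (rule distr_cong_AE) (use inv in auto)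
  finally show ?thesis by simp
qed

text \<open>The pair (y, u) is coded by the real \<open>e (y, u)\<close>, and the law of x with this
  code is uniformized over x; \<open>q\<close> decodes. The coordinate x is preserved at every
  point.\<close>

lemma coupling_uniformization:
  fixes M :: "'a measure" and \<pi> :: "('a \<times> 'b::{complete_space, second_countable_topology}) measure"
  assumes M: "prob_space M" and \<pi>: "prob_space \<pi>"
    and sets_\<pi>[measurable_cong]: "sets \<pi> = sets (M \<Otimes>\<^sub>M borel)"
    and marginal: "distr \<pi> M fst = M"
  obtains p q
  where "p \<in> \<pi> \<Otimes>\<^sub>M unit_borel \<rightarrow>\<^sub>M M \<Otimes>\<^sub>M unit_borel" "q \<in> M \<Otimes>\<^sub>M unit_borel \<rightarrow>\<^sub>M \<pi> \<Otimes>\<^sub>M unit_borel"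
    "distr (\<pi> \<Otimes>\<^sub>M unit_borel) (M \<Otimes>\<^sub>M unit_borel) p = M \<Otimes>\<^sub>M unit_borel"
    "AE w in \<pi> \<Otimes>\<^sub>M unit_borel. q (p w) = w"
    "\<And>w. fst (p w) = fst (fst w)" "\<And>z. fst (fst (q z)) = fst z"
proof -
  interpret pair_prob_space \<pi> unit_borel
    using \<pi> prob_space_unit_borel by (simp add: pair_prob_space_def pair_sigma_finite_def prob_space_imp_sigma_finite)
  let ?W = "\<pi> \<Otimes>\<^sub>M unit_borel"
  obtain e :: "'b \<times> real \<Rightarrow> real" and d :: "real \<Rightarrow> 'b \<times> real"
    where e: "e \<in> borel_measurable borel" and d: "d \<in> borel_measurable borel"
      and d_e: "\<And>x. d (e x) = x"
    using polish_borel_embedding[where 'a="'b \<times> real"] by metis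
  have [measurable]: "e \<in> borel \<Otimes>\<^sub>M borel \<rightarrow>\<^sub>M borel" "d \<in> borel \<rightarrow>\<^sub>M borel \<Otimes>\<^sub>M borel"
    using e d by (simp_all add: borel_prod)
  define \<phi> where "\<phi> w = (fst (fst w), e (snd (fst w), snd w))" for w :: "('a \<times> 'b) \<times> real"
  have [measurable]: "\<phi> \<in> ?W \<rightarrow>\<^sub>M M \<Otimes>\<^sub>M borel" unfolding \<phi>_def by measurable
  define R where "R = distr ?W (M \<Otimes>\<^sub>M borel) \<phi>"
  have [measurable_cong]: "sets R = sets (M \<Otimes>\<^sub>M borel)" by (simp add: R_def)
  have "prob_space R" unfolding R_def by (rule prob_space_distr) measurable
  have "distr R M fst = distr (distr ?W \<pi> fst) M fst"
    unfolding R_def by (simp add: distr_distr comp_def \<phi>_def)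
  also have "distr ?W \<pi> fst = \<pi>" by (rule prob_space.distr_pair_fst[OF prob_space_unit_borel])
  finally have "distr R M fst = M" by (simp add: marginal)
  have thin: "emeasure R E = 0" if E: "E \<in> sets R"
    and thin: "\<And>x z z'. (x, z) \<in> E \<Longrightarrow> (x, z') \<in> E \<Longrightarrow> z = z'" for E
  proof -
    have "emeasure R E = emeasure ?W (\<phi> -` E \<inter> space ?W)"
      using E unfolding R_def by (subst emeasure_distr) auto
    \<comment> \<open>For fixed (x, y), injectivity of \<open>e\<close> admits at most one u whose
      code lies over x in \<open>E\<close>.\<close>
    also have "\<dots> = 0"
    proof (rule emeasure_pair_thin_sections)
      show "\<phi> -` E \<inter> space ?W \<in> sets ?W" using E by measurable
      fix x :: "'a \<times> 'b" and s s'
      assume "(x, s) \<in> \<phi> -` E \<inter> space ?W" "(x, s') \<in> \<phi> -` E \<inter> space ?W"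
      then have "e (snd x, s) = e (snd x, s')"
        using thin by (auto simp: \<phi>_def)
      then show "s = s'" by (metis d_e prod.inject)
    qed
    finally show ?thesis .
  qed
  obtain v w where [measurable]: "v \<in> borel_measurable (M \<Otimes>\<^sub>M borel)" "w \<in> borel_measurable (M \<Otimes>\<^sub>M borel)"
    and v: "distr R (M \<Otimes>\<^sub>M unit_borel) (\<lambda>p. (fst p, v p)) = M \<Otimes>\<^sub>M unit_borel"
    and w: "AE p in R. w (fst p, v p) = snd p"
    using conditional_uniformization[OF M \<open>prob_space R\<close> \<open>sets R = _\<close> \<open>distr R M fst = M\<close> thin] by blast
  define p where "p x = (fst (\<phi> x), v (\<phi> x))" for x
  define q where "q z = ((fst z, fst (d (w z))), snd (d (w z)))" for z
  show thesis
  proof (rule that)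
    show p: "p \<in> ?W \<rightarrow>\<^sub>M M \<Otimes>\<^sub>M unit_borel" unfolding p_def by measurable
    show "q \<in> M \<Otimes>\<^sub>M unit_borel \<rightarrow>\<^sub>M ?W" unfolding q_def by measurable
    show "distr ?W (M \<Otimes>\<^sub>M unit_borel) p = M \<Otimes>\<^sub>M unit_borel"
      using v unfolding R_def by (subst (asm) distr_distr) (simp_all add: comp_def p_def[abs_def])
    have "AE x in ?W. w (fst (\<phi> x), v (\<phi> x)) = snd (\<phi> x)"
      using w unfolding R_def by (rule AE_distrD[rotated]) measurable
    then show "AE x in ?W. q (p x) = x"
    proof eventually_elim
      case (elim x)
      then show ?case by (cases x) (auto simp: q_def p_def \<phi>_def d_e)
    qed
  qed (simp_all add: p_def q_def \<phi>_def)
qed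

text \<open>The exceptional points on both sides form Borel sets containing a fibre \<open>{x} \<times> [0, 1]\<close>,
  so they embed into each other.\<close>

lemma borel_bijection_extending:
  fixes f :: "'a::{complete_space, second_countable_topology} \<times> real \<Rightarrow>
      'b::{complete_space, second_countable_topology} \<times> real"
  assumes f[measurable]: "f \<in> borel_measurable borel" and g[measurable]: "g \<in> borel_measurable borel"
  obtains T where "T \<in> borel_measurable borel" "bij_betw T (UNIV \<times> {0..1}) (UNIV \<times> {0..1})"
    "\<And>z. z \<in> UNIV \<times> {0..1} \<Longrightarrow> f z \<in> UNIV \<times> {0..1} \<Longrightarrow> g (f z) = z \<Longrightarrow>
      fst z \<noteq> x0 \<Longrightarrow> fst (f z) \<noteq> y0 \<Longrightarrow> T z = f z"
proof -
  define D :: "('a \<times> real) set" where "D = UNIV \<times> {0..1}"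
  define E :: "('b \<times> real) set" where "E = UNIV \<times> {0..1}"
  have [measurable]: "D \<in> sets borel" "E \<in> sets borel"
    unfolding D_def E_def by (auto intro!: borel_closed closed_Times)
  have [measurable]: "fst \<in> borel_measurable (borel :: ('a \<times> real) measure)"
    "fst \<in> borel_measurable (borel :: ('b \<times> real) measure)"
    "snd \<in> borel_measurable (borel :: ('a \<times> real) measure)"
    "snd \<in> borel_measurable (borel :: ('b \<times> real) measure)"
    by (simp_all flip: borel_prod)
  \<comment> \<open>On \<open>G\<close> and \<open>H\<close> the maps are mutually inverse; the
    fibres over \<open>x0\<close> and \<open>y0\<close> are left out to make room for the remaining
    points.\<close>
  define G where "G = {z. z \<in> D \<and> f z \<in> E \<and> g (f z) = z \<and> fst z \<noteq> x0 \<and> fst (f z) \<noteq> y0}"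
  define H where "H = {z. z \<in> E \<and> g z \<in> D \<and> f (g z) = z \<and> fst z \<noteq> y0 \<and> fst (g z) \<noteq> x0}"
  have [measurable]: "G \<in> sets borel" "H \<in> sets borel"
    unfolding G_def H_def by measurable
  have bij_f: "bij_betw f G H"
    by (rule bij_betw_byWitness[where f'=g]) (auto simp: G_def H_def)
  obtain e :: "'a \<times> real \<Rightarrow> real" and d where e: "e \<in> borel_measurable borel" "d \<in> borel_measurable borel"
      "\<And>x. d (e x) = x" "\<And>x. e x \<in> {0..1}"
    using polish_borel_embedding[where 'a="'a \<times> real"] by metis
  obtain e' :: "'b \<times> real \<Rightarrow> real" and d' where e': "e' \<in> borel_measurable borel" "d' \<in> borel_measurable borel"
      "\<And>x. d' (e' x) = x" "\<And>x. e' x \<in> {0..1}"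
    using polish_borel_embedding[where 'a="'b \<times> real"] by metis
  note [measurable] = e(1,2) e'(1,2)
  \<comment> \<open>\<open>D - G\<close> embeds into the fibre over \<open>y0\<close>, which misses
    \<open>H\<close>, with its code in [0,1] as second coordinate; symmetrically for
    \<open>E - H\<close>.\<close>
  obtain h where [measurable]: "h \<in> borel_measurable borel" and bij_h: "bij_betw h (D - G) (E - H)"
  proof (rule borel_Schroeder_Bernstein[of "D - G" "E - H" "\<lambda>z. (y0, e z)" "\<lambda>z. d (snd z)"
        "\<lambda>z. (x0, e' z)" "\<lambda>z. d' (snd z)"])
    show "D - G \<in> sets borel" "E - H \<in> sets borel" by measurable
    show "(\<lambda>z. (y0, e z)) \<in> borel_measurable borel" "(\<lambda>z. (x0, e' z)) \<in> borel_measurable borel"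
      unfolding borel_prod[symmetric] by (simp_all add: borel_prod)
    show "(\<lambda>z :: 'b \<times> real. d (snd z)) \<in> borel_measurable borel"
      "(\<lambda>z :: 'a \<times> real. d' (snd z)) \<in> borel_measurable borel"
      by measurable
    show "(\<lambda>z. (y0, e z)) ` (D - G) \<subseteq> E - H" "(\<lambda>z. (x0, e' z)) ` (E - H) \<subseteq> D - G"
      using e(4) e'(4) by (auto simp: D_def E_def G_def H_def)
  qed (simp_all add: e e')
  define T where "T z = (if z \<in> G then f z else h z)" for z
  have "bij_betw T (G \<union> (D - G)) (H \<union> (E - H))"
  proof (rule bij_betw_combine)
    show "bij_betw T G H" using bij_f by (rule bij_betw_cong[THEN iffD1, rotated]) (simp add: T_def)
    show "bij_betw T (D - G) (E - H)"
      using bij_h by (rule bij_betw_cong[THEN iffD1, rotated]) (simp add: T_def)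
  qed auto
  moreover have "G \<union> (D - G) = D" "H \<union> (E - H) = E" by (auto simp: G_def H_def)
  ultimately have "bij_betw T D E" by simp
  moreover have "T \<in> borel_measurable borel" unfolding T_def by measurable
  ultimately show thesis using that[of T] by (auto simp: T_def G_def D_def E_def)
qed

section \<open>Transfer between the line and the unit interval\<close>

lemma measurable_clamp_unit_lebesgue:
  assumes "sets M = sets borel"
  shows "(\<lambda>z. (fst z, max 0 (min 1 (snd z)))) \<in> M \<Otimes>\<^sub>M borel \<rightarrow>\<^sub>M M \<Otimes>\<^sub>M unit_lebesgue"
proof -
  have [measurable]: "(\<lambda>s. max 0 (min 1 s)) \<in> borel \<rightarrow>\<^sub>M unit_lebesgue"
    unfolding unit_lebesgue_def by (rule measurable_restrict_space2) auto
  show ?thesis by measurable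
qed

text \<open>Clamping fixes the strip over [0,1], so \<open>S\<close> is its own preimage under a
  measurable map, cut down to that strip.\<close>

lemma sets_pair_unit_lebesgue:
  assumes M: "sets M = sets (borel :: 'a::second_countable_topology measure)"
    and S: "S \<in> sets (M \<Otimes>\<^sub>M unit_lebesgue)"
  shows "S \<in> sets (M \<Otimes>\<^sub>M borel)"
proof -
  have sub: "S \<subseteq> UNIV \<times> {0..1}"
    using sets.sets_into_space[OF S] by (auto simp: space_pair_measure space_unit_lebesgue)
  have space: "space M = UNIV" using sets_eq_imp_space_eq[OF M] by simp
  have "S = ((\<lambda>z. (fst z, max 0 (min 1 (snd z)))) -` S \<inter> space (M \<Otimes>\<^sub>M borel)) \<inter> space M \<times> {0..1}"
    using sub by (auto simp: space_pair_measure space)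
  also have "\<dots> \<in> sets (M \<Otimes>\<^sub>M borel)"
    by (intro sets.Int measurable_sets[OF measurable_clamp_unit_lebesgue[OF M] S]) auto
  finally show "S \<in> sets (M \<Otimes>\<^sub>M borel)" .
qed

lemma measurable_pair_unit_borel: "(\<lambda>z. z) \<in> M \<Otimes>\<^sub>M unit_lebesgue \<rightarrow>\<^sub>M M \<Otimes>\<^sub>M unit_borel"
proof -
  have "(\<lambda>s. s) \<in> unit_lebesgue \<rightarrow>\<^sub>M unit_borel" by measurable
  from measurable_Pair[OF measurable_fst measurable_compose[OF measurable_snd this], of M]
  show ?thesis by simp
qed

lemma pair_unit_borel_eq_distr:
  "M \<Otimes>\<^sub>M unit_borel = distr (M \<Otimes>\<^sub>M unit_lebesgue) (M \<Otimes>\<^sub>M borel) (\<lambda>z. z)"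
proof -
  have "distr M M (\<lambda>x. x) \<Otimes>\<^sub>M unit_borel = distr (M \<Otimes>\<^sub>M unit_lebesgue) (M \<Otimes>\<^sub>M borel) (\<lambda>(x, s). (x, s))"
    unfolding unit_borel_def
    by (rule pair_measure_distr)
      (auto simp: prob_space_imp_sigma_finite[OF prob_space_unit_borel[unfolded unit_borel_def]])
  then show ?thesis by (simp add: id_def)
qed

lemma AE_pair_unit_borel:
  assumes "prob_space M" "sets M = sets (borel :: 'a::t1_space measure)" "emeasure M {x0} = 0"
  shows "AE z in M \<Otimes>\<^sub>M unit_borel. fst z \<noteq> x0 \<and> z \<in> UNIV \<times> {0..1}"
proof -
  interpret pair_prob_space M unit_borel
    using assms(1) prob_space_unit_borel by (simp add: pair_prob_space_def pair_sigma_finite_def prob_space_imp_sigma_finite)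
  have "AE x in M. x \<noteq> x0"
    using assms(2,3) AE_not_in[of "{x0}" M] by (auto simp: null_sets_def)
  then have "AE x in distr (M \<Otimes>\<^sub>M unit_borel) M fst. x \<noteq> x0"
    by (subst prob_space.distr_pair_fst[OF prob_space_unit_borel])
  then have 1: "AE z in M \<Otimes>\<^sub>M unit_borel. fst z \<noteq> x0"
    by (rule AE_distrD[rotated]) measurable
  have 2: "AE z in M \<Otimes>\<^sub>M unit_borel. snd z \<in> {0..1}"
  proof (rule AE_pair_measure)
    show "{z \<in> space (M \<Otimes>\<^sub>M unit_borel). snd z \<in> {0..1}} \<in> sets (M \<Otimes>\<^sub>M unit_borel)" by measurable
    show "AE x in M. AE s in unit_borel. snd (x, s) \<in> {0..1}" using AE_unit_borel by simp
  qed
  show ?thesis using 1 2 by eventually_elim (simp add: mem_Times_iff)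
qed

text \<open>A probability measure has only countably many atoms; uncountability of the spaces enters
  here.\<close>

lemma exists_null_point:
  assumes "prob_space M" "uncountable (UNIV :: 'a set)"
  shows "\<exists>x::'a. emeasure M {x} = 0"
proof -
  interpret prob_space M by fact
  have "{x. measure M {x} \<noteq> 0} \<noteq> UNIV" using countable_support assms(2) by metis
  then show ?thesis by (auto simp: emeasure_eq_measure)
qed

theorem theorem2p1:
  fixes \<mu> :: "'a::polish_space measure" and \<nu> :: "'b::polish_space measure"
    and \<pi> :: "('a \<times> 'b) measure"
  assumes "uncountable (UNIV :: 'a set)" and "uncountable (UNIV :: 'b set)"
    and "prob_space \<mu>" and "sets \<mu> = sets borel"
    and "prob_space \<nu>" and "sets \<nu> = sets borel"
    and "\<pi> \<in> Cpl \<mu> \<nu>"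
  shows "\<exists>T. T \<in> (borel \<Otimes>\<^sub>M unit_lebesgue) \<rightarrow>\<^sub>M (borel \<Otimes>\<^sub>M unit_lebesgue)
           \<and> bij_betw T (UNIV \<times> {0..1}) (UNIV \<times> {0..1})
           \<and> distr (\<mu> \<Otimes>\<^sub>M unit_lebesgue) (\<nu> \<Otimes>\<^sub>M unit_lebesgue) T = \<nu> \<Otimes>\<^sub>M unit_lebesgue
           \<and> (let \<pi>hat = distr (\<mu> \<Otimes>\<^sub>M unit_lebesgue)
                           ((\<mu> \<Otimes>\<^sub>M unit_lebesgue) \<Otimes>\<^sub>M (\<nu> \<Otimes>\<^sub>M unit_lebesgue))
                           (\<lambda>z. (z, T z))
              in distr \<pi>hat (\<mu> \<Otimes>\<^sub>M \<nu>) (\<lambda>((x, s), (y, t)). (x, y)) = \<pi>)"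
proof -
  note [measurable_cong] = \<open>sets \<mu> = sets borel\<close> \<open>sets \<nu> = sets borel\<close>
  have space: "space \<mu> = UNIV" "space \<nu> = UNIV"
    using assms(4,6)[THEN sets_eq_imp_space_eq] by simp_all
  have \<pi>: "prob_space \<pi>" "sets \<pi> = sets (\<mu> \<Otimes>\<^sub>M \<nu>)" "distr \<pi> \<mu> fst = \<mu>" "distr \<pi> \<nu> snd = \<nu>"
    using assms(7) by (auto simp: Cpl_def)
  note [measurable_cong] = \<pi>(2)
  have sets_\<pi>: "sets \<pi> = sets (\<mu> \<Otimes>\<^sub>M borel)"
    unfolding \<pi>(2) by (rule sets_pair_measure_cong) (simp_all add: assms)
  \<comment> \<open>\<open>coupling_uniformization\<close> preserves the first coordinate, so the
    coupling is reversed to treat Y.\<close>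
  define \<pi>' where "\<pi>' = distr \<pi> (\<nu> \<Otimes>\<^sub>M \<mu>) prod.swap"
  have [measurable]: "prod.swap \<in> \<pi> \<rightarrow>\<^sub>M \<nu> \<Otimes>\<^sub>M \<mu>"
    unfolding prod.swap_def by measurable
  have sets_\<pi>'[measurable_cong]: "sets \<pi>' = sets (\<nu> \<Otimes>\<^sub>M borel)"
    unfolding \<pi>'_def sets_distr by (rule sets_pair_measure_cong) (simp_all add: assms)
  have prob_\<pi>': "prob_space \<pi>'"
    unfolding \<pi>'_def by (rule prob_space.prob_space_distr[OF \<pi>(1)]) measurable
  have marg_\<pi>': "distr \<pi>' \<nu> fst = \<nu>"
    unfolding \<pi>'_def by (subst distr_distr) (simp_all add: comp_def \<pi>(4))
  let ?P = "\<mu> \<Otimes>\<^sub>M unit_borel" and ?Q = "\<nu> \<Otimes>\<^sub>M unit_borel"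
  let ?W = "\<pi> \<Otimes>\<^sub>M unit_borel" and ?W' = "\<pi>' \<Otimes>\<^sub>M unit_borel"
  obtain p q where p[measurable]: "p \<in> ?W \<rightarrow>\<^sub>M ?P" and q[measurable]: "q \<in> ?P \<rightarrow>\<^sub>M ?W"
    and p_distr: "distr ?W ?P p = ?P" and q_p: "AE w in ?W. q (p w) = w"
    and "\<And>w. fst (p w) = fst (fst w)" and fst_q: "\<And>z. fst (fst (q z)) = fst z"
    using coupling_uniformization[OF assms(3) \<pi>(1) sets_\<pi> \<pi>(3)] by blast
  obtain p' q' where p'[measurable]: "p' \<in> ?W' \<rightarrow>\<^sub>M ?Q" and q'[measurable]: "q' \<in> ?Q \<rightarrow>\<^sub>M ?W'"
    and p'_distr: "distr ?W' ?Q p' = ?Q" and q'_p': "AE w in ?W'. q' (p' w) = w"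
    and fst_p': "\<And>w. fst (p' w) = fst (fst w)" and "\<And>z. fst (fst (q' z)) = fst z"
    using coupling_uniformization[OF assms(5) prob_\<pi>' sets_\<pi>' marg_\<pi>'] by blast
  have q_distr: "distr ?P ?W q = ?W" by (rule distr_AE_left_inverse[OF p q p_distr q_p])
  define sw :: "('a \<times> 'b) \<times> real \<Rightarrow> ('b \<times> 'a) \<times> real" where "sw w = (prod.swap (fst w), snd w)" for w
  define sw' :: "('b \<times> 'a) \<times> real \<Rightarrow> ('a \<times> 'b) \<times> real" where "sw' w = (prod.swap (fst w), snd w)" for w
  have sw[measurable]: "sw \<in> ?W \<rightarrow>\<^sub>M ?W'" "sw' \<in> ?W' \<rightarrow>\<^sub>M ?W"
    unfolding sw_def sw'_def prod.swap_def by measurable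
  have sw_distr: "distr ?W ?W' sw = ?W'"
  proof -
    have "\<pi>' \<Otimes>\<^sub>M distr unit_borel unit_borel (\<lambda>s. s)
        = distr ?W ((\<nu> \<Otimes>\<^sub>M \<mu>) \<Otimes>\<^sub>M unit_borel) (\<lambda>(x, s). (prod.swap x, s))"
      unfolding \<pi>'_def
      by (rule pair_measure_distr) (auto simp: prob_space_imp_sigma_finite[OF prob_space_unit_borel])
    also have "\<dots> = distr ?W ?W' sw"
      by (rule distr_cong) (auto simp: sw_def \<pi>'_def intro!: sets_pair_measure_cong)
    finally show ?thesis by simp
  qed
  \<comment> \<open>Through X x Y x [0,1]: \<open>q\<close> splits the uniform variable into (y, u),
    and \<open>p'\<close> merges (x, u) into a uniform variable over y.\<close>
  define f where "f z = p' (sw (q z))" for z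
  define g where "g z = p (sw' (q' z))" for z
  have f[measurable]: "f \<in> ?P \<rightarrow>\<^sub>M ?Q" and g[measurable]: "g \<in> ?Q \<rightarrow>\<^sub>M ?P"
    unfolding f_def g_def by measurable
  have swq_distr: "distr ?P ?W' (\<lambda>z. sw (q z)) = ?W'"
    using distr_distr[OF sw(1) q] by (simp add: q_distr sw_distr comp_def)
  have f_distr: "distr ?P ?Q f = ?Q"
    using distr_distr[OF p', of "\<lambda>z. sw (q z)" ?P] by (simp add: swq_distr p'_distr comp_def f_def[abs_def])
  have sets_P: "sets ?P = sets borel" "sets ?Q = sets borel"
    by (simp_all add: borel_prod[symmetric] assms cong: sets_pair_measure_cong)
  \<comment> \<open>The identity holds at z = p w for almost every w, and \<open>p\<close> carries
    the law of w to that of z.\<close>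
  have p_q: "AE z in ?P. p (q z) = z"
  proof -
    have "AE w in ?W. p (q (p w)) = p w" using q_p by eventually_elim simp
    then have "AE z in distr ?W ?P p. p (q z) = z"
    proof (subst AE_distr_iff[OF p])
      have [measurable]: "(\<lambda>z. p (q z)) \<in> borel_measurable borel"
        using measurable_comp[OF q p] measurable_cong_sets[OF sets_P(1) sets_P(1)] by (simp add: comp_def)
      have "{z \<in> space borel. p (q z) = z} \<in> sets borel" by measurable
      then show "{z \<in> space ?P. p (q z) = z} \<in> sets ?P"
        using sets_P(1) sets_eq_imp_space_eq[OF sets_P(1)] by simp
    qed
    then show ?thesis by (subst (asm) p_distr)
  qed
  have g_f: "AE z in ?P. g (f z) = z"
  proof -
    have "AE z in distr ?P ?W' (\<lambda>z. sw (q z)). q' (p' z) = z" using q'_p' by (subst swq_distr)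
    then have "AE z in ?P. q' (p' (sw (q z))) = sw (q z)"
      by (rule AE_distrD[rotated]) measurable
    then show ?thesis using p_q by eventually_elim (simp add: f_def g_def sw_def sw'_def)
  qed
  \<comment> \<open>\<open>q\<close> keeps x and \<open>p'\<close> keeps y, so the X and Y
    coordinates of z and \<open>f z\<close> form the pair inside \<open>q z\<close>.\<close>
  have coords: "fst (q z) = (fst z, fst (f z))" for z
    using fst_q[of z] by (simp add: f_def fst_p' sw_def prod_eq_iff)
  obtain x0 y0 where x0: "emeasure \<mu> {x0} = 0" and y0: "emeasure \<nu> {y0} = 0"
    using exists_null_point assms(1-3,5) by metis
  have borel_fg: "f \<in> borel_measurable borel" "g \<in> borel_measurable borel"
    using f g measurable_cong_sets[OF sets_P] measurable_cong_sets[OF sets_P(2,1)] by simp_all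
  obtain T where T_borel: "T \<in> borel_measurable borel"
    and bij: "bij_betw T (UNIV \<times> {0..1}) (UNIV \<times> {0..1})"
    and T_f: "\<And>z. z \<in> UNIV \<times> {0..1} \<Longrightarrow> f z \<in> UNIV \<times> {0..1} \<Longrightarrow> g (f z) = z \<Longrightarrow>
      fst z \<noteq> x0 \<Longrightarrow> fst (f z) \<noteq> y0 \<Longrightarrow> T z = f z"
    using borel_bijection_extending[OF borel_fg, of x0 y0] by metis
  have T[measurable]: "T \<in> ?P \<rightarrow>\<^sub>M ?Q"
    using T_borel measurable_cong_sets[OF sets_P] by simp
  \<comment> \<open>Since \<open>f\<close> preserves the measures, the fibre over \<open>y0\<close>
    and the complement of the strip have null preimages.\<close>
  have AE_T: "AE z in ?P. T z = f z"
  proof -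
    have "AE z in distr ?P ?Q f. fst z \<noteq> y0 \<and> z \<in> UNIV \<times> {0..1}"
      unfolding f_distr by (rule AE_pair_unit_borel) fact+
    then have "AE z in ?P. fst (f z) \<noteq> y0 \<and> f z \<in> UNIV \<times> {0..1}"
      by (rule AE_distrD[rotated]) measurable
    moreover have "AE z in ?P. fst z \<noteq> x0 \<and> z \<in> UNIV \<times> {0..1}"
      by (rule AE_pair_unit_borel) fact+
    ultimately show ?thesis using g_f by eventually_elim (simp add: T_f)
  qed
  let ?L = "\<mu> \<Otimes>\<^sub>M unit_lebesgue" and ?L' = "\<nu> \<Otimes>\<^sub>M unit_lebesgue"
  note incl[measurable] = measurable_pair_unit_borel[of \<mu>] measurable_pair_unit_borel[of \<nu>]
  have P_L: "?P = distr ?L ?P (\<lambda>z. z)" "?Q = distr ?L' ?Q (\<lambda>z. z)"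
    by (subst pair_unit_borel_eq_distr, rule distr_cong; auto intro!: sets_pair_measure_cong)+
  \<comment> \<open>\<open>T\<close> maps the strip into itself, so clamping its second coordinate
    changes nothing there but gives measurability into \<open>unit_lebesgue\<close>.\<close>
  have T_L: "T \<in> ?L \<rightarrow>\<^sub>M ?L'"
  proof -
    have "(\<lambda>z. (fst (T z), max 0 (min 1 (snd (T z))))) \<in> ?L \<rightarrow>\<^sub>M ?L'"
    proof -
      have "(\<lambda>z. T z) \<in> ?L \<rightarrow>\<^sub>M \<nu> \<Otimes>\<^sub>M borel"
        using measurable_compose[OF incl(1) T] by (simp cong: measurable_cong_sets sets_pair_measure_cong)
      from measurable_compose[OF this measurable_clamp_unit_lebesgue[OF assms(6)]]
      show ?thesis by simp
    qed
    moreover have "(fst (T z), max 0 (min 1 (snd (T z)))) = T z" if "z \<in> space ?L" for z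
    proof -
      have "z \<in> UNIV \<times> {0..1}"
        using that by (auto simp: space_pair_measure space_unit_lebesgue)
      then have "T z \<in> UNIV \<times> {0..1}" using bij_betwE[OF bij] by blast
      then show ?thesis by (auto simp: mem_Times_iff prod_eq_iff)
    qed
    ultimately show ?thesis by (simp cong: measurable_cong)
  qed
  have "T \<in> borel \<Otimes>\<^sub>M unit_lebesgue \<rightarrow>\<^sub>M borel \<Otimes>\<^sub>M unit_lebesgue"
    using T_L measurable_cong_sets[OF sets_pair_measure_cong[OF assms(4) refl] sets_pair_measure_cong[OF assms(6) refl]]
    by blast
  moreover note bij
  \<comment> \<open>Both sides are computed on the line, where \<open>T\<close> may be replaced by
    \<open>f\<close> almost everywhere.\<close>
  moreover have "distr ?L ?L' T = ?L'"
  proof (rule measure_eqI)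
    fix S assume "S \<in> sets (distr ?L ?L' T)"
    then have S: "S \<in> sets ?L'" by simp
    have SQ: "S \<in> sets ?Q"
      using sets_pair_unit_lebesgue[OF assms(6) S] by (simp cong: sets_pair_measure_cong)
    have "emeasure (distr ?L ?L' T) S = emeasure ?L (T -` S \<inter> space ?L)"
      by (rule emeasure_distr[OF T_L S])
    also have "\<dots> = emeasure (distr ?L ?P (\<lambda>z. z)) (T -` S \<inter> space ?P)"
      by (subst emeasure_distr[OF incl(1) measurable_sets[OF T SQ]])
        (auto intro!: arg_cong2[where f=emeasure] simp: space_pair_measure space)
    also have "\<dots> = emeasure (distr ?P ?Q T) S"
      unfolding P_L(1)[symmetric] by (rule emeasure_distr[OF T SQ, symmetric])
    also have "distr ?P ?Q T = distr ?P ?Q f"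
      by (rule distr_cong_AE[OF refl refl AE_T T f])
    also have "\<dots> = distr ?L' ?Q (\<lambda>z. z)" using f_distr P_L(2) by simp
    also have "emeasure \<dots> S = emeasure ?L' S"
      using sets.sets_into_space[OF S]
      by (subst emeasure_distr[OF incl(2) SQ]) (auto intro!: arg_cong2[where f=emeasure])
    finally show "emeasure (distr ?L ?L' T) S = emeasure ?L' S" .
  qed simp
  moreover have "distr (distr ?L (?L \<Otimes>\<^sub>M ?L') (\<lambda>z. (z, T z))) (\<mu> \<Otimes>\<^sub>M \<nu>) (\<lambda>((x, s), (y, t)). (x, y)) = \<pi>"
  proof -
    note T_L[measurable]
    have "distr (distr ?L (?L \<Otimes>\<^sub>M ?L') (\<lambda>z. (z, T z))) (\<mu> \<Otimes>\<^sub>M \<nu>) (\<lambda>((x, s), (y, t)). (x, y))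
        = distr ?L (\<mu> \<Otimes>\<^sub>M \<nu>) (\<lambda>z. (fst z, fst (T z)))"
      unfolding case_prod_unfold by (subst distr_distr) (auto simp: comp_def)
    also have "\<dots> = distr (distr ?L ?P (\<lambda>z. z)) (\<mu> \<Otimes>\<^sub>M \<nu>) (\<lambda>z. (fst z, fst (T z)))"
      by (subst distr_distr) (auto simp: comp_def)
    \<comment> \<open>Almost everywhere the projected pair is the first component of
      \<open>q z\<close>, and \<open>q\<close> carries \<open>?P\<close> to \<open>?W\<close>, whose
      first marginal is \<open>\<pi>\<close>.\<close>
    also have "\<dots> = distr ?P \<pi> (\<lambda>z. fst (q z))"
      unfolding P_L(1)[symmetric]
    proof (rule distr_cong_AE)
      show "AE z in ?P. (fst z, fst (T z)) = fst (q z)"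
        using AE_T by eventually_elim (simp add: coords)
    qed (use \<pi>(2) in \<open>auto\<close>)
    also have "\<dots> = distr (distr ?P ?W q) \<pi> fst"
      by (subst distr_distr) (auto simp: comp_def)
    also have "\<dots> = \<pi>"
      unfolding q_distr by (rule prob_space.distr_pair_fst[OF prob_space_unit_borel])
    finally show ?thesis .
  qed
  ultimately show ?thesis unfolding Let_def by blast
qed

end
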